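(* Let $a\ge 0$ and let $(X,d_{\mathbf o},a)$ be an O-complete $a$-upward $\mathbf o$-metric space, with $\mathbf o:[a,\infty)\times[a,\infty)\to[a,\infty)$ nondecreasing in both variables, continuous at $(a,a)$, and $\mathbf o(a,a)=a$. Let $\alpha:X\times X\to[0,\infty)$ be a map, let $\psi\in\Psi$, and let $T:X\to X$ satisfy $\alpha(x,y)\,d_{\mathbf o}(Tx,Ty)\le\psi(d_{\mathbf o}(x,y))$ for all $x,y\in X$. Suppose that $T$ is $\alpha$-admissible and that $\alpha(x_0,Tx_0)\ge 1$ for some $x_0\in X$. If either (i) $T$ is sequentially continuous (with respect to O-convergence), or (ii) for any sequence $(x_n)_{n\ge 0}$ in $X$ such that $\alpha(x_n,x_{n+1})\ge 1$ for all $n\ge 0$, O-convergence of $(x_n)$ to $x$ implies that $\alpha(x_n,x)\ge 1$ for all $n$ sufficiently large, then $T$ has a fixed point.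
   Context: O-metric: let $X$ be a nonempty set, $a\ge 0$, and $\mathbf o:[a,\infty)\times[a,\infty)\to[a,\infty)$ a function, also written as a binary operation $u\,\mathbf o\,v=\mathbf o(u,v)$. $(X,d_{\mathbf o},a)$ is an $a$-upward $\mathbf o$-metric space if $d_{\mathbf o}:X\times X\to[a,\infty)$ satisfies, for all $x,y,z\in X$: (i) $d_{\mathbf o}(x,y)=a$ iff $x=y$; (ii) $d_{\mathbf o}(x,y)=d_{\mathbf o}(y,x)$; (iii) $d_{\mathbf o}(x,z)\le \mathbf o(d_{\mathbf o}(x,y),d_{\mathbf o}(y,z))$. A sequence $(x_n)$ O-converges to $x$ if $\lim_n d_{\mathbf o}(x_n,x)=a$; it is Cauchy if $\lim_{n,m\to\infty}d_{\mathbf o}(x_n,x_m)=a$. The space is O-complete if the Cauchy sequences are exactly the O-convergent sequences. $T$ is sequentially continuous if whenever $(x_n)$ O-converges to $x$, $(Tx_n)$ O-converges to $Tx$. For $i\ge 0$, $\Omega_i$ is the set of all functions $h:[a,\infty)^{i+1}\to[a,\infty)$ of the form $h(t_0,\dots,t_i)=t_0\,\mathbf o\,t_1\,\mathbf o\cdots\mathbf o\,t_i$ obtained from all possible ways of placing parentheses (order of arguments kept); $\Omega_0$ consists of the identity. $\Psi$ is the family of nondecreasing functions $\psi:[a,\infty)\to[a,\infty)$ for which there is a sequence of functions $(h_{i+1})_{i\ge 0}$ with $h_{i+1}\in\Omega_i$ such that for all $\epsilon>a$, $\lim_{n,i\to\infty}h_{i+1}\big(\psi^{(n)}(\epsilon),\psi^{(n+1)}(\epsilon),\dots,\psi^{(n+i)}(\epsilon)\big)=a$,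 where $\psi^{(n)}$ is the $n$-th iterate of $\psi$. $T$ is $\alpha$-admissible if for all $x,y\in X$, $\alpha(x,y)\ge 1$ implies $\alpha(Tx,Ty)\ge 1$. *)

theory Defs
  imports "HOL-Analysis.Analysis"
begin

definition o_metric_space :: "real \<Rightarrow> (real \<Rightarrow> real \<Rightarrow> real) \<Rightarrow> 'a set \<Rightarrow> ('a \<Rightarrow> 'a \<Rightarrow> real) \<Rightarrow> bool"
  where
  "o_metric_space a opn X d \<longleftrightarrow>
     a \<ge> 0 \<and> X \<noteq> {} \<and>
     opn \<in> {a..} \<rightarrow> {a..} \<rightarrow> {a..} \<and>
     d \<in> X \<rightarrow> X \<rightarrow> {a..} \<and>
     (\<forall>x\<in>X. \<forall>y\<in>X. d x y = a \<longleftrightarrow> x = y) \<and>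
     (\<forall>x\<in>X. \<forall>y\<in>X. d x y = d y x) \<and>
     (\<forall>x\<in>X. \<forall>y\<in>X. \<forall>z\<in>X. d x z \<le> opn (d x y) (d y z))"

definition O_converges :: "real \<Rightarrow> ('a \<Rightarrow> 'a \<Rightarrow> real) \<Rightarrow> (nat \<Rightarrow> 'a) \<Rightarrow> 'a \<Rightarrow> bool" where
  "O_converges a d s x \<longleftrightarrow> (\<lambda>n. d (s n) x) \<longlonglongrightarrow> a"

definition O_Cauchy :: "real \<Rightarrow> ('a \<Rightarrow> 'a \<Rightarrow> real) \<Rightarrow> (nat \<Rightarrow> 'a) \<Rightarrow> bool" where
  "O_Cauchy a d s \<longleftrightarrow>
     ((\<lambda>(n, m). d (s n) (s m)) \<longlongrightarrow> a) (sequentially \<times>\<^sub>F sequentially)"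

definition O_complete :: "real \<Rightarrow> 'a set \<Rightarrow> ('a \<Rightarrow> 'a \<Rightarrow> real) \<Rightarrow> bool" where
  "O_complete a X d \<longleftrightarrow>
     (\<forall>s. range s \<subseteq> X \<longrightarrow> (O_Cauchy a d s \<longleftrightarrow> (\<exists>x\<in>X. O_converges a d s x)))"

definition O_seq_continuous :: "real \<Rightarrow> 'a set \<Rightarrow> ('a \<Rightarrow> 'a \<Rightarrow> real) \<Rightarrow> ('a \<Rightarrow> 'a) \<Rightarrow> bool" where
  "O_seq_continuous a X d T \<longleftrightarrow>
     (\<forall>s x. range s \<subseteq> X \<and> x \<in> X \<and> O_converges a d s x
        \<longrightarrow> O_converges a d (\<lambda>n. T (s n)) (T x))"

text \<open>An argument tuple \<open>(t\<^sub>0, \<dots>, t\<^sub>i)\<close> is represented by a sequence \<open>t :: nat \<Rightarrow> real\<close> of which a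
  member of \<open>Omega opn i\<close> reads only the first \<open>i + 1\<close> entries (lemma \<open>Omega_cong\<close>). In the
  second rule the outermost operation splits the tuple into its first \<open>i + 1\<close> and its last
  \<open>j + 1\<close> entries.\<close>

inductive_set Omega_rel :: "(real \<Rightarrow> real \<Rightarrow> real) \<Rightarrow> (nat \<times> ((nat \<Rightarrow> real) \<Rightarrow> real)) set"
  for opn where
  single: "(0, \<lambda>t. t 0) \<in> Omega_rel opn"
| split: "\<lbrakk>(i, f) \<in> Omega_rel opn; (j, g) \<in> Omega_rel opn\<rbrakk>
    \<Longrightarrow> (i + j + 1, \<lambda>t. opn (f t) (g (\<lambda>k. t (i + 1 + k)))) \<in> Omega_rel opn"

definition Omega :: "(real \<Rightarrow> real \<Rightarrow> real) \<Rightarrow> nat \<Rightarrow> ((nat \<Rightarrow> real) \<Rightarrow> real) set" where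
  "Omega opn i = {h. (i, h) \<in> Omega_rel opn}"

lemma Omega_cong:
  assumes "h \<in> Omega opn i" and "\<And>k. k \<le> i \<Longrightarrow> t k = t' k"
  shows "h t = h t'"
proof -
  have "(i, h) \<in> Omega_rel opn"
    using assms(1) by (simp add: Omega_def)
  then have "\<forall>t t'. (\<forall>k\<le>i. t k = t' k) \<longrightarrow> h t = h t'"
  proof (induction rule: Omega_rel.induct)
    case (split i f j g)
    show ?case
    proof (intro allI impI)
      fix t t' :: "nat \<Rightarrow> real"
      assume eq: "\<forall>k\<le>i + j + 1. t k = t' k"
      have "f t = f t'" using split.IH(1) eq by simp
      moreover have "g (\<lambda>k. t (i + 1 + k)) = g (\<lambda>k. t' (i + 1 + k))"
        using split.IH(2) eq by simp
      ultimately show "opn (f t) (g (\<lambda>k. t (i + 1 + k))) = opn (f t') (g (\<lambda>k. t' (i + 1 + k)))"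
        by simp
    qed
  qed simp
  then show ?thesis using assms(2) by blast
qed

definition Psi :: "real \<Rightarrow> (real \<Rightarrow> real \<Rightarrow> real) \<Rightarrow> (real \<Rightarrow> real) set" where
  "Psi a opn = {\<psi>. \<psi> \<in> {a..} \<rightarrow> {a..} \<and> mono_on {a..} \<psi> \<and>
     (\<exists>h. (\<forall>i. h (i + 1) \<in> Omega opn i) \<and>
        (\<forall>\<epsilon>>a. ((\<lambda>(n, i). h (i + 1) (\<lambda>k. (\<psi> ^^ (n + k)) \<epsilon>)) \<longlongrightarrow> a)
           (sequentially \<times>\<^sub>F sequentially)))}"

definition alpha_admissible :: "'a set \<Rightarrow> ('a \<Rightarrow> 'a \<Rightarrow> real) \<Rightarrow> ('a \<Rightarrow> 'a) \<Rightarrow> bool" where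
  "alpha_admissible X \<alpha> T \<longleftrightarrow> (\<forall>x\<in>X. \<forall>y\<in>X. \<alpha> x y \<ge> 1 \<longrightarrow> \<alpha> (T x) (T y) \<ge> 1)"

end

theory Submission
  imports Defs
begin

text \<open>The Picard orbit \<open>x\<^sub>n = T\<^sup>n x\<^sub>0\<close> satisfies \<open>d x\<^sub>n x\<^sub>n\<^sub>+\<^sub>1 \<le> \<psi>\<^sup>n \<epsilon>\<close> with \<open>\<epsilon> = d x\<^sub>0 (T x\<^sub>0)\<close>, so
  chaining the triangle inequality along the parenthesisation \<open>h\<close> bounds \<open>d x\<^sub>n x\<^sub>n\<^sub>+\<^sub>i\<^sub>+\<^sub>1\<close> by a term that
  is close to \<open>a\<close> once both \<open>n\<close> and \<open>i\<close> are large. Two far points of the orbit are compared through a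
  third one much further out, which makes the orbit Cauchy by continuity of \<open>opn\<close> at \<open>(a, a)\<close>.
  Under hypothesis (ii) one needs \<open>\<psi> \<delta> \<rightarrow> a\<close> as \<open>\<delta> \<rightarrow> a\<close>. Nothing forces \<open>opn u v \<ge> u\<close> in
  general, but a distance \<open>r\<close> that occurs in \<open>X\<close> satisfies \<open>r \<le> opn r a\<close>. If \<open>\<psi> \<ge> r\<close> on all of
  \<open>{a<..}\<close>, every parenthesised iterate would therefore stay above \<open>r\<close>.\<close>

locale o_metric =
  fixes a :: real
    and opn :: "real \<Rightarrow> real \<Rightarrow> real"
    and X :: "'a set"
    and d :: "'a \<Rightarrow> 'a \<Rightarrow> real"
  assumes space: "o_metric_space a opn X d"
    and mono_left: "\<forall>v\<in>{a..}. mono_on {a..} (\<lambda>u. opn u v)"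
    and mono_right: "\<forall>u\<in>{a..}. mono_on {a..} (\<lambda>v. opn u v)"
    and cont: "continuous (at (a, a) within {a..} \<times> {a..}) (\<lambda>(u, v). opn u v)"
    and opn_aa: "opn a a = a"
begin

section \<open>Inequalities for \<open>opn\<close> and for parenthesised expressions\<close>

lemma a_nonneg: "a \<ge> 0"
  and d_ge: "x \<in> X \<Longrightarrow> y \<in> X \<Longrightarrow> a \<le> d x y"
  and d_eq_iff: "x \<in> X \<Longrightarrow> y \<in> X \<Longrightarrow> d x y = a \<longleftrightarrow> x = y"
  and d_commute: "x \<in> X \<Longrightarrow> y \<in> X \<Longrightarrow> d x y = d y x"
  and triangle: "x \<in> X \<Longrightarrow> y \<in> X \<Longrightarrow> z \<in> X \<Longrightarrow> d x z \<le> opn (d x y) (d y z)"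
  using space unfolding o_metric_space_def by (auto simp: Pi_iff)

lemma opn_mono:
  assumes "a \<le> u" "u \<le> u'" "a \<le> v" "v \<le> v'"
  shows "opn u v \<le> opn u' v'"
proof -
  have "opn u v \<le> opn u' v"
    using mono_left assms by (auto simp: mono_on_def)
  also have "\<dots> \<le> opn u' v'"
    using mono_right assms by (auto simp: mono_on_def)
  finally show ?thesis .
qed

text \<open>Continuity at \<open>(a, a)\<close> in the form of a square neighbourhood, so that the
  two arguments can be made small independently.\<close>

lemma opn_close:
  assumes "e > a"
  obtains b where "b > a"
    and "\<And>u v. a \<le> u \<Longrightarrow> u < b \<Longrightarrow> a \<le> v \<Longrightarrow> v < b \<Longrightarrow> opn u v < e"
proof -
  have "((\<lambda>(u, v). opn u v) \<longlongrightarrow> a) (at (a, a) within {a..} \<times> {a..})"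
    using cont opn_aa by (simp add: continuous_within)
  then have "\<forall>\<^sub>F p in at (a, a) within {a..} \<times> {a..}. (case p of (u, v) \<Rightarrow> opn u v) < e"
    using assms order_tendstoD(2) by blast
  then obtain r where "r > 0" and r: "\<And>p. p \<in> {a..} \<times> {a..} \<Longrightarrow> p \<noteq> (a, a) \<Longrightarrow> dist p (a, a) < r
      \<Longrightarrow> (case p of (u, v) \<Rightarrow> opn u v) < e"
    unfolding eventually_at by blast
  \<comment> \<open>The Euclidean distance of a pair is at most the sum of the coordinate distances,
    hence the half radius. The filter \<open>at\<close> omits the point \<open>(a, a)\<close>
    itself, where \<open>opn_aa\<close> gives the value.\<close>
  have "opn u v < e" if "a \<le> u" "u < a + r / 2" "a \<le> v" "v < a + r / 2" for u v
  proof (cases "(u, v) = (a, a)")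
    case True
    then show ?thesis using opn_aa assms by simp
  next
    case False
    have "dist (u, v) (a, a) \<le> \<bar>u - a\<bar> + \<bar>v - a\<bar>"
      using sqrt_sum_squares_le_sum_abs[of "u - a" "v - a"] by (simp add: dist_Pair_Pair dist_real_def)
    also have "\<dots> < r" using that by simp
    finally show ?thesis using r[of "(u, v)"] False that by simp
  qed
  then show thesis using that[of "a + r / 2"] \<open>r > 0\<close> by simp
qed

text \<open>The outermost operation splits the chain of points at \<open>s (Suc i)\<close>: the
  triangle inequality is applied there, and monotonicity inserts the bounds for both halves. The
  right half is a shifted chain with shifted bounds, so \<open>s\<close> and \<open>t\<close> vary
  in the induction.\<close>

lemma chain_le_Omega_rel:
  assumes "(i, h) \<in> Omega_rel opn"
    and "range s \<subseteq> X"
    and "\<And>k. d (s k) (s (Suc k)) \<le> t k"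
  shows "d (s 0) (s (Suc i)) \<le> h t"
  using assms
proof (induction arbitrary: s t rule: Omega_rel.induct)
  case single
  then show ?case by simp
next
  case (split i f j g)
  have s: "s k \<in> X" for k using split.prems(1) by auto
  have 1: "d (s 0) (s (Suc i)) \<le> f t"
    using split.IH(1) split.prems by blast
  have 2: "d (s (Suc i)) (s (Suc (i + j + 1))) \<le> g (\<lambda>k. t (i + 1 + k))"
    using split.IH(2)[of "\<lambda>k. s (i + 1 + k)" "\<lambda>k. t (i + 1 + k)"] split.prems(2) s
    by (auto simp: add.commute add.left_commute)
  have "d (s 0) (s (Suc (i + j + 1))) \<le> opn (d (s 0) (s (Suc i))) (d (s (Suc i)) (s (Suc (i + j + 1))))"
    by (intro triangle s)
  also have "\<dots> \<le> opn (f t) (g (\<lambda>k. t (i + 1 + k)))"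
    by (intro opn_mono d_ge s 1 2)
  finally show ?case .
qed

lemma distance_le_Omega_rel:
  assumes "(i, h) \<in> Omega_rel opn"
    and "x \<in> X" "y \<in> X"
    and "\<And>k. d x y \<le> t k"
  shows "d x y \<le> h t"
  using assms(1,4)
proof (induction arbitrary: t rule: Omega_rel.induct)
  case single
  then show ?case by simp
next
  case (split i f j g)
  have yy: "d y y = a" using d_eq_iff assms(3) by blast
  \<comment> \<open>The triangle inequality with \<open>y\<close> itself as intermediate point.
    Afterwards the left argument grows to \<open>f t\<close>, and \<open>a\<close> grows to the
    right argument, which is at least \<open>d x y\<close>.\<close>
  have "d x y \<le> opn (d x y) a"
    using triangle[OF assms(2,3,3)] yy by simp
  also have "\<dots> \<le> opn (f t) (g (\<lambda>k. t (i + 1 + k)))"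
    using split d_ge[OF assms(2,3)] by (intro opn_mono) (auto intro: order_trans)
  finally show ?case .
qed

section \<open>Limits and Cauchy sequences\<close>

lemma tendsto_aI:
  assumes "\<And>n. a \<le> f n" and "\<And>e. e > a \<Longrightarrow> \<forall>\<^sub>F n in F. f n < e"
  shows "(f \<longlongrightarrow> a) F"
  by (rule order_tendstoI) (use assms in \<open>auto intro: always_eventually less_le_trans\<close>)

lemma O_converges_unique:
  assumes "range s \<subseteq> X" "x \<in> X" "y \<in> X" "O_converges a d s x" "O_converges a d s y"
  shows "x = y"
proof (rule ccontr)
  assume "x \<noteq> y"
  then have "d x y > a"
    using d_ge d_eq_iff assms(2,3) by (metis order_le_less)
  then obtain b where "b > a"
    and b: "\<And>u v. a \<le> u \<Longrightarrow> u < b \<Longrightarrow> a \<le> v \<Longrightarrow> v < b \<Longrightarrow> opn u v < d x y"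
    using opn_close by blast
  have "\<forall>\<^sub>F n in sequentially. d (s n) x < b \<and> d (s n) y < b"
    using assms(4,5) \<open>b > a\<close> unfolding O_converges_def
    by (intro eventually_conj order_tendstoD)
  then obtain n where n: "d (s n) x < b" "d (s n) y < b"
    using eventually_happens' sequentially_bot by blast
  have "s n \<in> X" using assms(1) by auto
  with n b[of "d x (s n)" "d (s n) y"] triangle[of x "s n" y] show False
    using assms(2,3) d_ge d_commute by fastforce
qed

text \<open>The assumption \<open>far\<close> says nothing about indices that are close together;
  such a pair is joined through a third index far beyond both.\<close>

lemma O_CauchyI:
  assumes s: "range s \<subseteq> X"
    and far: "\<And>b. b > a \<Longrightarrow> \<exists>N. \<forall>n\<ge>N. \<forall>i\<ge>N. d (s n) (s (n + Suc i)) < b"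
  shows "O_Cauchy a d s"
  unfolding O_Cauchy_def
proof (rule tendsto_aI)
  have sX: "s n \<in> X" for n using s by auto
  show "a \<le> (case p of (n, m) \<Rightarrow> d (s n) (s m))" for p
    by (cases p) (simp add: d_ge sX)
  fix e assume "e > a"
  then obtain b where "b > a"
    and b: "\<And>u v. a \<le> u \<Longrightarrow> u < b \<Longrightarrow> a \<le> v \<Longrightarrow> v < b \<Longrightarrow> opn u v < e"
    using opn_close by blast
  obtain N where N: "\<And>n i. n \<ge> N \<Longrightarrow> i \<ge> N \<Longrightarrow> d (s n) (s (n + Suc i)) < b"
    using far[OF \<open>b > a\<close>] by blast
  have "d (s n) (s m) < e" if "n \<ge> N" "m \<ge> N" for n m
  proof -
    \<comment> \<open>This index exceeds \<open>n\<close> by \<open>Suc (m + N)\<close> and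
      \<open>m\<close> by \<open>Suc (n + N)\<close>, so \<open>far\<close> applies to both
      pairs.\<close>
    let ?k = "n + m + Suc N"
    have "d (s n) (s ?k) < b" "d (s m) (s ?k) < b"
      using N[of n "m + N"] N[of m "n + N"] that by (simp_all add: algebra_simps)
    then have "opn (d (s n) (s ?k)) (d (s ?k) (s m)) < e"
      using b d_ge d_commute sX by metis
    then show ?thesis using triangle[of "s n" "s ?k" "s m"] sX by fastforce
  qed
  then show "\<forall>\<^sub>F p in sequentially \<times>\<^sub>F sequentially. (case p of (n, m) \<Rightarrow> d (s n) (s m)) < e"
    by (auto simp: eventually_prod_sequentially)
qed

section \<open>Iterates of \<psi> and consequences of membership in \<open>Psi\<close>\<close>

lemma funpow_ge:
  assumes "\<psi> \<in> Psi a opn" "a \<le> t"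
  shows "a \<le> (\<psi> ^^ n) t"
  using assms by (induction n) (auto simp: Psi_def Pi_iff)

lemma funpow_bound:
  assumes "\<psi> \<in> Psi a opn" "\<And>n. a \<le> u n" "\<And>n. u (Suc n) \<le> \<psi> (u n)"
  shows "u n \<le> (\<psi> ^^ n) (u 0)"
proof (induction n)
  case (Suc n)
  have "u (Suc n) \<le> \<psi> (u n)" by (rule assms(3))
  also have "\<dots> \<le> \<psi> ((\<psi> ^^ n) (u 0))"
    using assms(1) Suc assms(2) funpow_ge[OF assms(1,2)]
    by (auto simp: Psi_def intro: mono_onD)
  finally show ?case by simp
qed simp

lemma O_Cauchy_if_Psi_bound:
  assumes s: "range s \<subseteq> X" and psi: "\<psi> \<in> Psi a opn"
    and "s 0 \<noteq> s 1"
    and step: "\<And>n. d (s (Suc n)) (s (Suc (Suc n))) \<le> \<psi> (d (s n) (s (Suc n)))"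
  shows "O_Cauchy a d s"
proof (rule O_CauchyI[OF s])
  have sX: "s n \<in> X" for n using s by auto
  define \<epsilon> where "\<epsilon> = d (s 0) (s 1)"
  \<comment> \<open>The limit in \<open>Psi\<close> is available only for starting values strictly
    above \<open>a\<close>.\<close>
  have "\<epsilon> > a"
    unfolding \<epsilon>_def using d_ge d_eq_iff sX \<open>s 0 \<noteq> s 1\<close> by (metis order_le_less)
  have bound: "d (s n) (s (Suc n)) \<le> (\<psi> ^^ n) \<epsilon>" for n
    unfolding \<epsilon>_def using funpow_bound[OF psi, of "\<lambda>n. d (s n) (s (Suc n))"] step d_ge sX by simp
  obtain h where h: "\<And>i. h (i + 1) \<in> Omega opn i"
    and lim: "((\<lambda>(n, i). h (i + 1) (\<lambda>k. (\<psi> ^^ (n + k)) \<epsilon>)) \<longlongrightarrow> a)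
           (sequentially \<times>\<^sub>F sequentially)"
    using psi \<open>\<epsilon> > a\<close> unfolding Psi_def by blast
  \<comment> \<open>The \<open>i + 1\<close> arguments read by \<open>h (i + 1)\<close> bound the
    \<open>i + 1\<close> steps from \<open>s n\<close> to \<open>s (n + Suc i)\<close>.\<close>
  have chain: "d (s n) (s (n + Suc i)) \<le> h (i + 1) (\<lambda>k. (\<psi> ^^ (n + k)) \<epsilon>)" for n i
    using chain_le_Omega_rel[of i "h (i + 1)" "\<lambda>k. s (n + k)" "\<lambda>k. (\<psi> ^^ (n + k)) \<epsilon>"]
      h[of i] sX bound[of "n + _"] by (auto simp: Omega_def)
  fix b assume "b > a"
  then obtain N where "\<And>n i. n \<ge> N \<Longrightarrow> i \<ge> N \<Longrightarrow> h (i + 1) (\<lambda>k. (\<psi> ^^ (n + k)) \<epsilon>) < b"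
    using order_tendstoD(2)[OF lim \<open>b > a\<close>] by (auto simp: eventually_prod_sequentially)
  then show "\<exists>N. \<forall>n\<ge>N. \<forall>i\<ge>N. d (s n) (s (n + Suc i)) < b"
    using chain by (meson le_less_trans)
qed

lemma Psi_less_distance:
  assumes psi: "\<psi> \<in> Psi a opn" and xy: "x \<in> X" "y \<in> X" "x \<noteq> y"
  obtains \<delta> where "\<delta> > a" "\<psi> \<delta> < d x y"
proof (rule ccontr)
  assume "\<not> thesis"
  then have big: "d x y \<le> \<psi> \<delta>" if "\<delta> > a" for \<delta>
    using that \<open>\<And>\<delta>. a < \<delta> \<Longrightarrow> \<psi> \<delta> < d x y \<Longrightarrow> thesis\<close> by force
  have gt: "d x y > a"
    using d_ge d_eq_iff xy by (metis order_le_less)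
  \<comment> \<open>Each iterate is at least \<open>d x y\<close>, hence above \<open>a\<close>, so
    \<open>big\<close> applies to it again.\<close>
  have iter: "d x y \<le> (\<psi> ^^ n) (d x y)" for n
    by (induction n) (use big gt in auto)
  obtain h where h: "\<And>i. h (i + 1) \<in> Omega opn i"
    and lim: "((\<lambda>(n, i). h (i + 1) (\<lambda>k. (\<psi> ^^ (n + k)) (d x y))) \<longlongrightarrow> a)
           (sequentially \<times>\<^sub>F sequentially)"
    using psi gt unfolding Psi_def by blast
  obtain N where "\<And>n i. n \<ge> N \<Longrightarrow> i \<ge> N \<Longrightarrow> h (i + 1) (\<lambda>k. (\<psi> ^^ (n + k)) (d x y)) < d x y"
    using order_tendstoD(2)[OF lim gt] by (auto simp: eventually_prod_sequentially)
  then have "h (N + 1) (\<lambda>k. (\<psi> ^^ (N + k)) (d x y)) < d x y" by blast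
  moreover have "d x y \<le> h (N + 1) (\<lambda>k. (\<psi> ^^ (N + k)) (d x y))"
    using distance_le_Omega_rel[of N] h xy iter by (auto simp: Omega_def)
  ultimately show False by simp
qed

lemma O_converges_image:
  assumes psi: "\<psi> \<in> Psi a opn" and T: "T \<in> X \<rightarrow> X"
    and s: "range s \<subseteq> X" and x: "x \<in> X" and conv: "O_converges a d s x"
    and le: "\<forall>\<^sub>F n in sequentially. d (T (s n)) (T x) \<le> \<psi> (d (s n) x)"
  shows "O_converges a d (\<lambda>n. T (s n)) (T x)"
  unfolding O_converges_def
proof (rule tendsto_aI)
  have sX: "s n \<in> X" for n using s by auto
  have TX: "T y \<in> X" if "y \<in> X" for y using T that by auto
  show "a \<le> d (T (s n)) (T x)" for n
    by (intro d_ge TX sX x)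
  fix e assume "e > a"
  have near: "\<forall>\<^sub>F n in sequentially. d (s n) x < b" if "b > a" for b
    using conv that unfolding O_converges_def by (rule order_tendstoD)
  show "\<forall>\<^sub>F n in sequentially. d (T (s n)) (T x) < e"
  \<comment> \<open>\<open>Psi_less_distance\<close> pushes \<psi> only below distances that occur
    in \<open>X\<close>, so one smaller than \<open>e\<close> is sought. If no other point lies
    within \<open>e\<close> of \<open>x\<close>, then \<open>x\<close> is isolated and the sequence
    is eventually constant.\<close>
  proof (cases "\<exists>y\<in>X. y \<noteq> x \<and> d y x < e")
    case True
    then obtain y where y: "y \<in> X" "y \<noteq> x" "d y x < e" by blast
    obtain \<delta> where \<delta>: "\<delta> > a" "\<psi> \<delta> < d y x"
      using Psi_less_distance[OF psi y(1) x y(2)] .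
    from near[OF \<delta>(1)] le show ?thesis
    proof eventually_elim
      case (elim n)
      have "\<psi> (d (s n) x) \<le> \<psi> \<delta>"
        using psi d_ge[OF sX x, of n] elim(1) \<delta>(1) by (auto simp: Psi_def intro: mono_onD)
      then show ?case using elim \<delta>(2) y(3) by simp
    qed
  next
    case False
    from near[OF \<open>e > a\<close>] show ?thesis
    proof eventually_elim
      case (elim n)
      then have "s n = x" using False sX by blast
      then show ?case using d_eq_iff[of "T x" "T x"] TX[OF x] \<open>e > a\<close> by simp
    qed
  qed
qed

end

section \<open>The fixed point as limit of the Picard orbit\<close>

theorem theorem5p2:
  fixes a :: real
    and opn :: "real \<Rightarrow> real \<Rightarrow> real"
    and X :: "'a set"
    and d :: "'a \<Rightarrow> 'a \<Rightarrow> real"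
    and \<alpha> :: "'a \<Rightarrow> 'a \<Rightarrow> real"
    and \<psi> :: "real \<Rightarrow> real"
    and T :: "'a \<Rightarrow> 'a"
  assumes "a \<ge> 0"
    and "o_metric_space a opn X d"
    and "O_complete a X d"
    and "\<forall>v\<in>{a..}. mono_on {a..} (\<lambda>u. opn u v)"
    and "\<forall>u\<in>{a..}. mono_on {a..} (\<lambda>v. opn u v)"
    and "continuous (at (a, a) within {a..} \<times> {a..}) (\<lambda>(u, v). opn u v)"
    and "opn a a = a"
    and "\<alpha> \<in> X \<rightarrow> X \<rightarrow> {0..}"
    and "\<psi> \<in> Psi a opn"
    and "T \<in> X \<rightarrow> X"
    and "\<forall>x\<in>X. \<forall>y\<in>X. \<alpha> x y * d (T x) (T y) \<le> \<psi> (d x y)"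
    and "alpha_admissible X \<alpha> T"
    and "\<exists>x0\<in>X. \<alpha> x0 (T x0) \<ge> 1"
    and "O_seq_continuous a X d T \<or>
      (\<forall>s x. range s \<subseteq> X \<and> x \<in> X \<and> (\<forall>n. \<alpha> (s n) (s (n + 1)) \<ge> 1) \<and> O_converges a d s x
         \<longrightarrow> (\<forall>\<^sub>F n in sequentially. \<alpha> (s n) x \<ge> 1))"
  shows "\<exists>x\<in>X. T x = x"
proof -
  interpret o_metric a opn X d
    by unfold_locales (use assms in auto)
  obtain x0 where x0: "x0 \<in> X" "\<alpha> x0 (T x0) \<ge> 1" using assms(13) by blast
  define s where "s n = (T ^^ n) x0" for n
  have s_Suc: "s (Suc n) = T (s n)" for n by (simp add: s_def)
  have sX: "s n \<in> X" for n
    by (induction n) (use x0 assms(10) in \<open>auto simp: s_def\<close>)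
  have TX: "T y \<in> X" if "y \<in> X" for y using assms(10) that by auto
  have s_alpha: "\<alpha> (s n) (s (n + 1)) \<ge> 1" for n
  proof (induction n)
    case 0
    then show ?case using x0 by (simp add: s_def)
  next
    case (Suc n)
    then show ?case
      using assms(12) sX[of n] sX[of "Suc n"] unfolding alpha_admissible_def by (auto simp: s_Suc)
  qed
  \<comment> \<open>Distances are nonnegative because \<open>a\<close> is, so a factor of at least 1
    only enlarges them.\<close>
  have contr: "d (T x) (T y) \<le> \<psi> (d x y)" if "x \<in> X" "y \<in> X" "\<alpha> x y \<ge> 1" for x y
  proof -
    have "d (T x) (T y) \<le> \<alpha> x y * d (T x) (T y)"
      using mult_right_mono[OF that(3), of "d (T x) (T y)"] d_ge[of "T x" "T y"] TX that a_nonneg by simp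
    also have "\<dots> \<le> \<psi> (d x y)" using assms(11) that by blast
    finally show ?thesis .
  qed
  show ?thesis
  \<comment> \<open>Equality already makes \<open>x0\<close> a fixed point; otherwise the first step
    of the orbit is longer than \<open>a\<close>.\<close>
  proof (cases "s 0 = s 1")
    case True
    then have "T x0 = x0" by (simp add: s_def)
    then show ?thesis using x0(1) by blast
  next
    case False
    have "O_Cauchy a d s"
    proof (rule O_Cauchy_if_Psi_bound[OF _ assms(9) False])
      show "d (s (Suc n)) (s (Suc (Suc n))) \<le> \<psi> (d (s n) (s (Suc n)))" for n
        using contr[OF sX sX, of n "Suc n"] s_alpha[of n] by (simp add: s_Suc)
    qed (use sX in auto)
    then obtain x where x: "x \<in> X" "O_converges a d s x"
      using assms(3) sX unfolding O_complete_def by blast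
    have "O_converges a d (\<lambda>n. T (s n)) (T x)"
      using assms(14)
    proof
      assume "O_seq_continuous a X d T"
      then show ?thesis using x sX unfolding O_seq_continuous_def by blast
    next
      assume "\<forall>s x. range s \<subseteq> X \<and> x \<in> X \<and> (\<forall>n. \<alpha> (s n) (s (n + 1)) \<ge> 1) \<and> O_converges a d s x
         \<longrightarrow> (\<forall>\<^sub>F n in sequentially. \<alpha> (s n) x \<ge> 1)"
      then have "\<forall>\<^sub>F n in sequentially. \<alpha> (s n) x \<ge> 1"
        using x sX s_alpha by blast
      then have "\<forall>\<^sub>F n in sequentially. d (T (s n)) (T x) \<le> \<psi> (d (s n) x)"
        by eventually_elim (use contr sX x in blast)
      then show ?thesis
        using O_converges_image[OF assms(9,10)] sX x by blast
    qed
    \<comment> \<open>The image sequence is the orbit shifted by one, so it keeps the limit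
      \<open>x\<close>; uniqueness of limits then identifies \<open>T x\<close> with
      \<open>x\<close>.\<close>
    moreover have "O_converges a d (\<lambda>n. T (s n)) x"
      using x(2) LIMSEQ_Suc unfolding O_converges_def by (fastforce simp: s_Suc)
    ultimately have "T x = x"
      using O_converges_unique[of "\<lambda>n. T (s n)" "T x" x] TX sX x(1) by blast
    then show ?thesis using x(1) by blast
  qed
qed

end
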